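(* Let $\Phi\subset\mathbb{R}^3$ be a skew ruled $C^3$-surface, parametrized by $\boldsymbol{x}(u,v)=\boldsymbol{s}(u)+v\,\boldsymbol{e}(u)$, $u\in I$, $v\in\mathbb{R}$, where $\boldsymbol{s}$ is the striction line, $\boldsymbol{e}$ is a unit vector field along the rulings and $u$ is the arclength of the spherical curve $\boldsymbol{e}$. Let $k$, $\delta$ be its conical curvature and parameter of distribution, and let $w=\sqrt{v^2+\delta(u)^2}$. Suppose that the normal curvature $k_N$ along the curves of constant Gaussian curvature of $\Phi$ has the form $$k_N=f(u)\,w^{n},\qquad n\in\mathbb{Z},\quad f\in C^0(I).$$ Then one of the following occurs: (a) $f=0$ and $\Phi$ is a right helicoid. (b) $n=-1$, $f(u)=-k(u)$ and $\Phi$ is either an orthoid ruled surface of constant parameter of distribution or an Edlinger-surface.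
   Context: $I\subset\mathbb{R}$ is an open interval. A skew (non-developable) ruled $C^3$-surface $\Phi$ is a regular ruled surface of class $C^3$ without torsal rulings, parametrized on $I\times\mathbb{R}$ by $\boldsymbol{x}(u,v)=\boldsymbol{s}(u)+v\,\boldsymbol{e}(u)$ with $|\boldsymbol{e}|=1$, $|\boldsymbol{e}'|=1$ and $\langle\boldsymbol{s}',\boldsymbol{e}'\rangle=0$ on $I$ (so $\boldsymbol{s}$ is the striction line and $u$ is the arclength of $\boldsymbol{e}$); prime denotes $d/du$. Its invariants are the conical curvature $k=(\boldsymbol{e},\boldsymbol{e}',\boldsymbol{e}'')$ and the parameter of distribution $\delta=(\boldsymbol{e},\boldsymbol{e}',\boldsymbol{s}')$ (both triple products; $\delta\neq0$ on $I$ by skewness), and the striction $\sigma=\sphericalangle(\boldsymbol{e},\boldsymbol{s}')$ with $-\pi/2<\sigma\le\pi/2$ and $\operatorname{sign}\sigma=\operatorname{sign}\delta$. Put $\lambda:=\cot\sigma$. The normal curvature at $(u,v)$ in direction $du:dv$ is $$k_N=\frac1w\cdot\frac{-[kv^2+\delta' v+\delta^2(k-\lambda)]\,du^2+2\delta\,du\,dv}{[v^2+\delta^2(\lambda^2+1)]\,du^2+2\delta\lambda\,du\,dv+dv^2}.$$ The Gaussian curvature is $K=-\delta^2/w^4$. The family of curves of constant Gaussian curvature (curves along which $K$ is constant) is determined by $\delta'(\delta^2-v^2)\,du+2\delta v\,dv=0$. An Edlinger-surface is a skew ruled surface whose osculating quadrics are rotational hyperboloids; a necessary and sufficient condition is $\delta'=k\lambda+1=0$.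 A ruled surface is called orthoid if its rulings are perpendicular to the striction line, i.e. $\lambda=0$. Constant parameter of distribution means $\delta'=0$. A right helicoid is the case $k=\lambda=\delta'=0$. *)

theory Defs
  imports "HOL-Analysis.Analysis"
begin

definition open_interval :: "real set \<Rightarrow> bool" where
  "open_interval I \<longleftrightarrow> open I \<and> is_interval I \<and> I \<noteq> {}"

abbreviation vderiv :: "(real \<Rightarrow> 'a::real_normed_vector) \<Rightarrow> real \<Rightarrow> 'a" where
  "vderiv c u \<equiv> vector_derivative c (at u)"

primrec Ck_on :: "nat \<Rightarrow> (real \<Rightarrow> 'a::real_normed_vector) \<Rightarrow> real set \<Rightarrow> bool" where
  "Ck_on 0 c I \<longleftrightarrow> continuous_on I c"
| "Ck_on (Suc n) c I \<longleftrightarrow> (\<forall>u\<in>I. c differentiable (at u)) \<and> Ck_on n (vderiv c) I"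

definition triple :: "real^3 \<Rightarrow> real^3 \<Rightarrow> real^3 \<Rightarrow> real" where
  "triple a b c = a \<bullet> cross3 b c"

text \<open>The angle in \<open>[0, pi]\<close> between two nonzero vectors.\<close>

definition vec_angle :: "real^3 \<Rightarrow> real^3 \<Rightarrow> real" where
  "vec_angle a b = arccos (a \<bullet> b / (norm a * norm b))"


section \<open>Parametrized surfaces\<close>

type_synonym surface = "real \<Rightarrow> real \<Rightarrow> real^3"

definition pd_u :: "surface \<Rightarrow> surface" where
  "pd_u x u v = vderiv (\<lambda>t. x t v) u"

definition pd_v :: "surface \<Rightarrow> surface" where
  "pd_v x u v = vderiv (\<lambda>t. x u t) v"

definition unit_normal :: "surface \<Rightarrow> surface" where
  "unit_normal x u v = sgn (cross3 (pd_u x u v) (pd_v x u v))"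

definition ff_E :: "surface \<Rightarrow> real \<Rightarrow> real \<Rightarrow> real" where
  "ff_E x u v = pd_u x u v \<bullet> pd_u x u v"
definition ff_F :: "surface \<Rightarrow> real \<Rightarrow> real \<Rightarrow> real" where
  "ff_F x u v = pd_u x u v \<bullet> pd_v x u v"
definition ff_G :: "surface \<Rightarrow> real \<Rightarrow> real \<Rightarrow> real" where
  "ff_G x u v = pd_v x u v \<bullet> pd_v x u v"

definition ff_L :: "surface \<Rightarrow> real \<Rightarrow> real \<Rightarrow> real" where
  "ff_L x u v = pd_u (pd_u x) u v \<bullet> unit_normal x u v"
definition ff_M :: "surface \<Rightarrow> real \<Rightarrow> real \<Rightarrow> real" where
  "ff_M x u v = pd_v (pd_u x) u v \<bullet> unit_normal x u v"
definition ff_N :: "surface \<Rightarrow> real \<Rightarrow> real \<Rightarrow> real" where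
  "ff_N x u v = pd_v (pd_v x) u v \<bullet> unit_normal x u v"

text \<open>Normal curvature at \<open>(u, v)\<close> in the direction \<open>du : dv\<close>.\<close>

definition normal_curvature :: "surface \<Rightarrow> real \<Rightarrow> real \<Rightarrow> real \<Rightarrow> real \<Rightarrow> real" where
  "normal_curvature x u v du dv =
     (ff_L x u v * du\<^sup>2 + 2 * ff_M x u v * du * dv + ff_N x u v * dv\<^sup>2) /
     (ff_E x u v * du\<^sup>2 + 2 * ff_F x u v * du * dv + ff_G x u v * dv\<^sup>2)"

definition gauss_curvature :: "surface \<Rightarrow> real \<Rightarrow> real \<Rightarrow> real" where
  "gauss_curvature x u v =
     (ff_L x u v * ff_N x u v - (ff_M x u v)\<^sup>2) /
     (ff_E x u v * ff_G x u v - (ff_F x u v)\<^sup>2)"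

text \<open>A regular curve \<open>c\<close>, given in the parameter domain \<open>I \<times> \<real>\<close>, along which the
  Gaussian curvature is constant.\<close>

definition constant_curvature_curve ::
    "surface \<Rightarrow> real set \<Rightarrow> real set \<Rightarrow> (real \<Rightarrow> real \<times> real) \<Rightarrow> bool" where
  "constant_curvature_curve x I J c \<longleftrightarrow>
     open_interval J \<and> Ck_on 1 c J \<and>
     (\<forall>t\<in>J. fst (c t) \<in> I \<and> vderiv c t \<noteq> 0) \<and>
     (\<lambda>t. gauss_curvature x (fst (c t)) (snd (c t))) constant_on J"


section \<open>Ruled surfaces and their invariants\<close>

definition ruled :: "(real \<Rightarrow> real^3) \<Rightarrow> (real \<Rightarrow> real^3) \<Rightarrow> surface" where
  "ruled s e u v = s u + v *\<^sub>R e u"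

definition con_curv :: "(real \<Rightarrow> real^3) \<Rightarrow> real \<Rightarrow> real" where
  "con_curv e u = triple (e u) (vderiv e u) (vderiv (vderiv e) u)"

definition dist_param :: "(real \<Rightarrow> real^3) \<Rightarrow> (real \<Rightarrow> real^3) \<Rightarrow> real \<Rightarrow> real" where
  "dist_param s e u = triple (e u) (vderiv e u) (vderiv s u)"

text \<open>The signed angle from \<open>e\<close> to \<open>s'\<close>, with the sign of the parameter of distribution.
  It lies in \<open>(-pi, pi)\<close>; reducing it modulo \<open>pi\<close> to \<open>(-pi/2, pi/2]\<close> does not
  affect its cotangent, which is the only quantity used below. That cotangent equals
  \<open>(s' \<bullet> e) / dist_param s e\<close>.\<close>

definition striction :: "(real \<Rightarrow> real^3) \<Rightarrow> (real \<Rightarrow> real^3) \<Rightarrow> real \<Rightarrow> real" where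
  "striction s e u = sgn (dist_param s e u) * vec_angle (e u) (vderiv s u)"

definition lam :: "(real \<Rightarrow> real^3) \<Rightarrow> (real \<Rightarrow> real^3) \<Rightarrow> real \<Rightarrow> real" where
  "lam s e u = cot (striction s e u)"

definition dist_w :: "(real \<Rightarrow> real^3) \<Rightarrow> (real \<Rightarrow> real^3) \<Rightarrow> real \<Rightarrow> real \<Rightarrow> real" where
  "dist_w s e u v = sqrt (v\<^sup>2 + (dist_param s e u)\<^sup>2)"

text \<open>The surface is of class \<open>C\<^sup>3\<close> if it has a \<open>C\<^sup>3\<close> directrix \<open>r\<close> and a \<open>C\<^sup>3\<close>
  spherical image \<open>e\<close>. The striction line is then in general only \<open>C\<^sup>2\<close>, so it is not required
  to be \<open>C\<^sup>3\<close> itself; taking \<open>r = s\<close> gives the case where \<open>ruled s e\<close> is a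
  \<open>C\<^sup>3\<close> map.\<close>

definition ruled_C3 :: "real set \<Rightarrow> (real \<Rightarrow> real^3) \<Rightarrow> (real \<Rightarrow> real^3) \<Rightarrow> bool" where
  "ruled_C3 I s e \<longleftrightarrow>
     Ck_on 3 e I \<and> (\<forall>u\<in>I. s differentiable (at u)) \<and>
     (\<exists>r. Ck_on 3 r I \<and> (\<forall>u\<in>I. \<exists>m. r u = s u + m *\<^sub>R e u))"

text \<open>The last conjunct says that no ruling is torsal.\<close>

definition skew_ruled_C3 :: "real set \<Rightarrow> (real \<Rightarrow> real^3) \<Rightarrow> (real \<Rightarrow> real^3) \<Rightarrow> bool" where
  "skew_ruled_C3 I s e \<longleftrightarrow>
     open_interval I \<and> ruled_C3 I s e \<and>
     (\<forall>u\<in>I. norm (e u) = 1 \<and> norm (vderiv e u) = 1 \<and> vderiv s u \<bullet> vderiv e u = 0) \<and>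
     (\<forall>u\<in>I. \<forall>v. cross3 (pd_u (ruled s e) u v) (pd_v (ruled s e) u v) \<noteq> 0) \<and>
     (\<forall>u\<in>I. dist_param s e u \<noteq> 0)"


section \<open>Special ruled surfaces\<close>

definition constant_dist_param :: "real set \<Rightarrow> (real \<Rightarrow> real^3) \<Rightarrow> (real \<Rightarrow> real^3) \<Rightarrow> bool" where
  "constant_dist_param I s e \<longleftrightarrow> (\<forall>u\<in>I. deriv (dist_param s e) u = 0)"

definition right_helicoid :: "real set \<Rightarrow> (real \<Rightarrow> real^3) \<Rightarrow> (real \<Rightarrow> real^3) \<Rightarrow> bool" where
  "right_helicoid I s e \<longleftrightarrow>
     (\<forall>u\<in>I. con_curv e u = 0 \<and> lam s e u = 0 \<and> deriv (dist_param s e) u = 0)"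

text \<open>Orthoid: the rulings are perpendicular to the striction line.\<close>

definition orthoid :: "real set \<Rightarrow> (real \<Rightarrow> real^3) \<Rightarrow> (real \<Rightarrow> real^3) \<Rightarrow> bool" where
  "orthoid I s e \<longleftrightarrow> (\<forall>u\<in>I. vderiv s u \<bullet> e u = 0)"

definition quadratic_fun :: "(real^3 \<Rightarrow> real) \<Rightarrow> bool" where
  "quadratic_fun q \<longleftrightarrow>
     (\<exists>(A :: real^3^3) b c. transpose A = A \<and> A \<noteq> 0 \<and>
        q = (\<lambda>X. X \<bullet> (A *v X) + b \<bullet> X + c))"

text \<open>The osculating quadric along the ruling at \<open>u\<close>: the quadric through three consecutive
  rulings, i.e. having contact of second order with the surface at every point of the ruling.
  Along a non-torsal ruling these conditions determine \<open>q\<close> up to a factor.\<close>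

definition osculating_quadric :: "surface \<Rightarrow> real \<Rightarrow> (real^3) set \<Rightarrow> bool" where
  "osculating_quadric x u Q \<longleftrightarrow>
     (\<exists>q. quadratic_fun q \<and> Q = {X. q X = 0} \<and>
        (\<forall>v. \<forall>j\<le>2. (deriv ^^ j) (\<lambda>t. q (x t v)) u = 0))"

text \<open>The one-sheeted hyperboloid with centre \<open>m\<close>, axis of rotation \<open>d\<close> and semi-axes
  \<open>a, a, c\<close>.\<close>

definition rotational_hyperboloid :: "(real^3) set \<Rightarrow> bool" where
  "rotational_hyperboloid Q \<longleftrightarrow>
     (\<exists>m d a c. norm d = 1 \<and> a > 0 \<and> c > 0 \<and>
        Q = {X. ((norm (X - m))\<^sup>2 - ((X - m) \<bullet> d)\<^sup>2) / a\<^sup>2 - ((X - m) \<bullet> d)\<^sup>2 / c\<^sup>2 = 1})"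

definition edlinger :: "real set \<Rightarrow> (real \<Rightarrow> real^3) \<Rightarrow> (real \<Rightarrow> real^3) \<Rightarrow> bool" where
  "edlinger I s e \<longleftrightarrow>
     (\<forall>u\<in>I. \<exists>Q. osculating_quadric (ruled s e) u Q \<and> rotational_hyperboloid Q)"

end

theory Submission
  imports Defs
begin

text \<open>
  Fix \<open>u\<close> and a point \<open>v \<noteq> 0\<close> of the ruling. The curve of constant Gaussian
  curvature through it has direction \<open>2 \<delta> v : \<delta>' (v\<^sup>2 - \<delta>\<^sup>2)\<close>, so the hypothesis becomes
  \<open>N(v) = f w\<^sup>n\<^sup>+\<^sup>1 D(v)\<close> with polynomials \<open>N\<close>, \<open>D\<close> in \<open>v\<close>. Letting
  \<open>v\<close> tend to \<open>0\<close> gives \<open>\<delta>' = 0\<close> where \<open>f \<noteq> 0\<close>; then, up to a common factor, \<open>N\<close> and \<open>D\<close>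
  depend on \<open>w\<close> only, and comparing coefficients of polynomials in \<open>w\<close> forces \<open>n = -1\<close>, \<open>f = -k\<close>
  and \<open>\<lambda> = 0\<close> or \<open>k \<lambda> = -1\<close>. Where \<open>f = 0\<close>, \<open>N = 0\<close> gives \<open>k = \<lambda> = \<delta>' = 0\<close>. Since
  \<open>k \<lambda>\<close> is continuous with values in \<open>{0, -1}\<close>, one alternative holds on the whole interval.
\<close>

section \<open>Vector algebra, derivatives of inner products, and identity of polynomials\<close>

text \<open>The remainder \<open>y\<close> is orthogonal to \<open>a\<close>, \<open>b\<close> and
  \<open>z\<close>. By Lagrange's identity \<open>cross3 y z\<close> is a combination of
  \<open>a\<close> and \<open>b\<close> with coefficients \<open>y \<bullet> b\<close> and
  \<open>- (y \<bullet> a)\<close>, so it vanishes; a vector both orthogonal and parallel to the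
  unit vector \<open>z\<close> is zero.\<close>

lemma cross3_expansion_orthonormal:
  fixes a b x :: "real^3"
  assumes "a \<bullet> a = 1" "b \<bullet> b = 1" "a \<bullet> b = 0"
  shows "x = (x \<bullet> a) *\<^sub>R a + (x \<bullet> b) *\<^sub>R b + (x \<bullet> cross3 a b) *\<^sub>R cross3 a b"
proof -
  define z where "z = cross3 a b"
  define y where "y = x - ((x \<bullet> a) *\<^sub>R a + (x \<bullet> b) *\<^sub>R b + (x \<bullet> z) *\<^sub>R z)"
  have zz: "z \<bullet> z = 1" "z \<bullet> a = 0" "z \<bullet> b = 0" "a \<bullet> z = 0" "b \<bullet> z = 0" "b \<bullet> a = 0"
    using assms by (auto simp: z_def dot_cross dot_cross_self inner_commute)
  have ya: "y \<bullet> a = 0" "y \<bullet> b = 0" "y \<bullet> z = 0"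
    by (auto simp: y_def inner_diff_left inner_add_left assms zz)
  have "cross3 y z = 0"
    unfolding z_def by (simp add: Lagrange ya)
  then have "y = 0"
    using cross_dot_cancel[of z y 0] ya zz
    by (metis cross_skew cross_zero_right inner_commute inner_zero_left inner_zero_right neg_equal_0_iff_equal zero_neq_one)
  then show ?thesis by (simp add: y_def z_def)
qed

lemma inner_deriv_const:
  fixes a b :: "real \<Rightarrow> 'a::real_inner"
  assumes "open I" "u \<in> I" "\<And>t. t \<in> I \<Longrightarrow> a t \<bullet> b t = c"
    and "(a has_vector_derivative a') (at u)" "(b has_vector_derivative b') (at u)"
  shows "a u \<bullet> b' + a' \<bullet> b u = 0"
proof -
  have "((\<lambda>t. a t \<bullet> b t) has_vector_derivative (a u \<bullet> b' + a' \<bullet> b u)) (at u)"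
    by (rule bounded_bilinear.has_vector_derivative[OF bounded_bilinear_inner assms(4,5)])
  moreover have "((\<lambda>t. a t \<bullet> b t) has_vector_derivative 0) (at u)"
    by (rule has_vector_derivative_transform_within_open[OF has_vector_derivative_const assms(1,2)])
      (rule assms(3)[symmetric])
  ultimately show ?thesis by (rule vector_derivative_unique_at)
qed

lemma bounded_bilinear_cross3: "bounded_bilinear cross3"
  using bilinear_cross bilinear_conv_bounded_bilinear by blast

lemma cot_arccos: "\<bar>x\<bar> < 1 \<Longrightarrow> cot (arccos x) = x / sqrt (1 - x\<^sup>2)"
  by (simp add: cot_def cos_arccos_abs sin_arccos_abs)

lemma poly_eq_if_infinite:
  fixes p q :: "'a::{comm_ring_1,ring_no_zero_divisors} poly"
  assumes "infinite A" "\<And>x. x \<in> A \<Longrightarrow> poly p x = poly q x"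
  shows "p = q"
proof (rule ccontr)
  assume "p \<noteq> q"
  then have "finite {x. poly (p - q) x = 0}" by (intro poly_roots_finite) simp
  moreover have "A \<subseteq> {x. poly (p - q) x = 0}" using assms(2) by auto
  ultimately show False using assms(1) finite_subset by blast
qed

section \<open>Algebra of the curvature condition on a single ruling\<close>

text \<open>Here \<open>x\<close> stands for \<open>w\<close>, \<open>F\<close> for the value of
  \<open>f\<close> and \<open>m\<close> for \<open>n + 1\<close>. Once a negative power of
  \<open>x\<close> is moved to the other side, both sides are polynomials that agree on an infinite
  set, so coefficients can be compared.\<close>

lemma power_relation_coefficients:
  fixes k l d F :: real and m :: int
  assumes d: "d \<noteq> 0" and F: "F \<noteq> 0"
    and H: "\<And>x. x > \<bar>d\<bar> \<Longrightarrow> - k * x\<^sup>2 + d\<^sup>2 * l = F * x powi m * (x\<^sup>2 + d\<^sup>2 * l\<^sup>2)"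
  shows "m = 0 \<and> F = - k \<and> (l = 0 \<or> k * l = - 1)"
proof -
  define p where "p = [: d\<^sup>2 * l, 0, - k :]"
  define q where "q = [: F * (d\<^sup>2 * l\<^sup>2), 0, F :]"
  have p: "poly p x = - k * x\<^sup>2 + d\<^sup>2 * l" for x by (simp add: p_def power2_eq_square)
  have q: "poly q x = F * (x\<^sup>2 + d\<^sup>2 * l\<^sup>2)" for x
    by (simp add: q_def power2_eq_square algebra_simps)
  have inf: "infinite {\<bar>d\<bar><..}" by (rule infinite_Ioi)
  consider j where "m = int j" | j where "m = - int (Suc j)"
    by (metis int_cases)
  then show ?thesis
  proof cases
    case 1
    have eq: "p = monom 1 j * q"
    proof (rule poly_eq_if_infinite[OF inf])
      fix x assume "x \<in> {\<bar>d\<bar><..}"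
      then show "poly p x = poly (monom 1 j * q) x"
        using H[of x] 1 by (simp add: p q poly_monom)
    qed
    \<comment> \<open>\<open>F\<close> is the leading coefficient of \<open>q\<close>, so the right
      side has degree \<open>j + 2\<close>, while \<open>p\<close> has degree at most 2.\<close>
    have "coeff p (j + 2) = F" unfolding eq by (simp add: coeff_monom_mult q_def numeral_2_eq_2)
    then have "j = 0" using F by (cases j) (auto simp: p_def numeral_2_eq_2)
    then have "p = q" using eq by simp
    then have "F = - k" "d\<^sup>2 * l = F * (d\<^sup>2 * l\<^sup>2)" by (auto simp: p_def q_def)
    moreover have "d\<^sup>2 * (l * (k * l + 1)) = d\<^sup>2 * l + k * (d\<^sup>2 * l\<^sup>2)"
      by (simp add: algebra_simps power2_eq_square)
    ultimately have "d\<^sup>2 * (l * (k * l + 1)) = 0" by simp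
    with \<open>F = - k\<close> show ?thesis using 1 \<open>j = 0\<close> d by (auto simp: add_eq_0_iff)
  next
    case 2
    have eq: "monom 1 (Suc j) * p = q"
    proof (rule poly_eq_if_infinite[OF inf])
      fix x assume "x \<in> {\<bar>d\<bar><..}"
      then have "x \<noteq> 0" "x > \<bar>d\<bar>" by auto
      then have "x ^ Suc j * x powi m = 1" using 2 by (simp add: power_int_minus del: power_Suc of_nat_Suc)
      then have "x ^ Suc j * (F * x powi m * (x\<^sup>2 + d\<^sup>2 * l\<^sup>2)) = F * (x\<^sup>2 + d\<^sup>2 * l\<^sup>2)" 
        by (metis mult.assoc mult.left_commute mult_1)
      then show "poly (monom 1 (Suc j) * p) x = poly q x"
        using H[OF \<open>x > \<bar>d\<bar>\<close>] by (simp add: p q poly_monom del: power_Suc)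
    qed
    \<comment> \<open>The left side is divisible by \<open>x\<close>, so the constant term of
      \<open>q\<close> vanishes and \<open>l = 0\<close>. Then \<open>p\<close> is a multiple of the
      square of \<open>x\<close>, and the product has no term of degree 2, against
      \<open>F \<noteq> 0\<close>.\<close>
    have "coeff (monom 1 (Suc j) * p) 0 = 0" by (simp add: coeff_monom_mult)
    then have "l = 0" unfolding eq using F d by (simp add: q_def)
    moreover have "coeff (monom 1 (Suc j) * p) 2 = F" unfolding eq by (simp add: q_def numeral_2_eq_2)
    ultimately have False using F
      by (auto simp: coeff_monom_mult p_def coeff_pCons numeral_2_eq_2 split: nat.splits if_splits)
    then show ?thesis ..
  qed
qed

text \<open>Here \<open>d1\<close> is \<delta>' and \<open>q v\<close> is the slope dv/du of the
  curve of constant Gaussian curvature, whose denominator excludes \<open>v = 0\<close>. The factor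
  1/w in the normal curvature raises the exponent to \<open>n + 1\<close>.\<close>

lemma normal_curvature_relation:
  fixes k l d d1 F :: real and n :: int
  defines "q \<equiv> \<lambda>v. d1 * (v\<^sup>2 - d\<^sup>2) / (2 * d * v)"
  assumes d: "d \<noteq> 0"
    and H: "\<And>v. v \<noteq> 0 \<Longrightarrow>
      (- (k * v\<^sup>2 + d1 * v + d\<^sup>2 * (k - l)) + 2 * d * q v) / sqrt (v\<^sup>2 + d\<^sup>2) /
        (v\<^sup>2 + d\<^sup>2 * (l\<^sup>2 + 1) + 2 * (d * l) * q v + (q v)\<^sup>2) = F * sqrt (v\<^sup>2 + d\<^sup>2) powi n"
  shows "d1 = 0 \<and> F = - k \<and> (F = 0 \<and> l = 0 \<or> n = - 1 \<and> (l = 0 \<or> k * l = - 1))"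
proof -
  define w where "w = (\<lambda>v. sqrt (v\<^sup>2 + d\<^sup>2))"
  \<comment> \<open>\<open>N\<close> and \<open>D\<close> are the numerator (without 1/w) and the
    denominator of the normal curvature, both multiplied by the square of \<open>2 * d * v\<close>
    to clear the denominators of \<open>q v\<close>.\<close>
  define N where "N = (\<lambda>v. 4 * d\<^sup>2 * v * (- k * v ^ 3 - d\<^sup>2 * (k - l) * v - d1 * d\<^sup>2))"
  define D where "D = (\<lambda>v. 4 * d\<^sup>2 * v\<^sup>2 * (v\<^sup>2 + d\<^sup>2 * (l\<^sup>2 + 1))
      + 4 * d\<^sup>2 * l * v * d1 * (v\<^sup>2 - d\<^sup>2) + (d1 * (v\<^sup>2 - d\<^sup>2))\<^sup>2)"
  have wpos: "w v > 0" for v using d by (auto simp: w_def intro!: add_nonneg_pos)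
  have eq: "N v = F * w v powi (n + 1) * D v" if v: "v \<noteq> 0" for v
  proof -
    let ?A = "- (k * v\<^sup>2 + d1 * v + d\<^sup>2 * (k - l)) + 2 * d * q v"
    let ?B = "v\<^sup>2 + d\<^sup>2 * (l\<^sup>2 + 1) + 2 * (d * l) * q v + (q v)\<^sup>2"
    \<comment> \<open>Completing the square shows that the first fundamental form is positive, so it
      can be multiplied across.\<close>
    have "?B = (q v + d * l)\<^sup>2 + (v\<^sup>2 + d\<^sup>2)" by (simp add: power2_eq_square algebra_simps)
    moreover have "v\<^sup>2 + d\<^sup>2 > 0" using d by (auto intro!: add_nonneg_pos)
    ultimately have B: "?B > 0" by (metis add_nonneg_pos zero_le_power2)
    have "?A / w v / ?B = F * w v powi n" using H[OF v] by (simp add: w_def)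
    then have "?A = F * (w v powi n * w v) * ?B"
      using B wpos[of v] by (smt (verit) mult.assoc mult.commute nonzero_eq_divide_eq)
    also have "w v powi n * w v = w v powi (n + 1)" using wpos[of v] by (simp add: power_int_add)
    finally have "4 * d\<^sup>2 * v\<^sup>2 * ?A = F * w v powi (n + 1) * (4 * d\<^sup>2 * v\<^sup>2 * ?B)" by simp
    moreover have qv: "2 * d * v * q v = d1 * (v\<^sup>2 - d\<^sup>2)" using d v by (simp add: q_def)
    have "4 * d\<^sup>2 * v\<^sup>2 * ?A = N v"
    proof -
      have "4 * d\<^sup>2 * v\<^sup>2 * ?A = 4 * d\<^sup>2 * v\<^sup>2 * - (k * v\<^sup>2 + d1 * v + d\<^sup>2 * (k - l)) + 4 * d\<^sup>2 * v * (2 * d * v * q v)"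
        by (simp add: algebra_simps power2_eq_square)
      then show ?thesis unfolding qv N_def by (simp add: algebra_simps power2_eq_square power3_eq_cube)
    qed
    moreover have "4 * d\<^sup>2 * v\<^sup>2 * ?B = D v"
    proof -
      have "4 * d\<^sup>2 * v\<^sup>2 * ?B = 4 * d\<^sup>2 * v\<^sup>2 * (v\<^sup>2 + d\<^sup>2 * (l\<^sup>2 + 1))
           + 4 * d\<^sup>2 * l * v * (2 * d * v * q v) + (2 * d * v * q v)\<^sup>2"
        by (simp add: algebra_simps power2_eq_square)
      then show ?thesis unfolding qv D_def by (simp add: algebra_simps)
    qed
    ultimately show ?thesis by simp
  qed
  show ?thesis
  proof (cases "F = 0")
    case True
    \<comment> \<open>Up to the factor \<open>4 * d\<^sup>2 * v\<close>, \<open>N\<close> is a cubic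
      in \<open>v\<close> without quadratic term; three nonzero values of \<open>v\<close> suffice
      to make its three coefficients vanish.\<close>
    have "N 1 = 0" "N (-1) = 0" "N 2 = 0" using eq[of 1] eq[of "-1"] eq[of 2] True by auto
    then have a: "- k - d\<^sup>2 * (k - l) - d1 * d\<^sup>2 = 0" "k + d\<^sup>2 * (k - l) - d1 * d\<^sup>2 = 0"
       "- 8 * k - 2 * (d\<^sup>2 * (k - l)) - d1 * d\<^sup>2 = 0"
      using d by (auto simp: N_def)
    then have "d1 * d\<^sup>2 = 0" "k = 0" by linarith+
    moreover from this a have "d\<^sup>2 * (k - l) = 0" by linarith
    ultimately show ?thesis using d True by auto
  next
    case F: False
    have "d1 = 0"
    proof -
      \<comment> \<open>The relation is known only off \<open>v = 0\<close>, but both sides are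
        continuous there. \<open>N 0\<close> vanishes, while \<open>D 0\<close> is the square of
        \<open>d1 * d\<^sup>2\<close>.\<close>
      have "(N \<longlongrightarrow> N 0) (at 0)"
        unfolding N_def by (intro tendsto_intros)
      moreover have "((\<lambda>v. F * w v powi (n + 1) * D v) \<longlongrightarrow> F * w 0 powi (n + 1) * D 0) (at 0)"
        using wpos[of 0] unfolding w_def D_def by (intro tendsto_intros) auto
      then have "(N \<longlongrightarrow> F * w 0 powi (n + 1) * D 0) (at 0)"
        by (rule Lim_transform_within[of _ _ _ _ 1]) (use eq in auto)
      ultimately have "N 0 = F * w 0 powi (n + 1) * D 0"
        by (intro tendsto_unique[of "at 0" N]) auto
      then show ?thesis using F wpos[of 0] d by (auto simp: N_def D_def)
    qed
    have "n + 1 = 0 \<and> F = - k \<and> (l = 0 \<or> k * l = - 1)"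
    proof (rule power_relation_coefficients[OF d F])
      fix x assume x: "x > \<bar>d\<bar>"
      \<comment> \<open>Every \<open>x\<close> above \<open>\<bar>d\<bar>\<close> is the value of
        \<open>w\<close> at this positive \<open>v\<close>, so \<open>w\<close> can serve as the
        free variable after the common factor \<open>4 * d\<^sup>2 * v\<^sup>2\<close> is
        cancelled.\<close>
      define v where "v = sqrt (x\<^sup>2 - d\<^sup>2)"
      have "x\<^sup>2 > d\<^sup>2" using x by (metis abs_ge_zero power2_abs power_strict_mono zero_less_numeral)
      then have v: "v > 0" "v\<^sup>2 = x\<^sup>2 - d\<^sup>2" by (auto simp: v_def)
      have "w v = x" using x by (simp add: w_def v)
      have Nv: "N v = 4 * d\<^sup>2 * v\<^sup>2 * (- k * v\<^sup>2 - d\<^sup>2 * (k - l))"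
        by (simp add: N_def \<open>d1 = 0\<close> algebra_simps power2_eq_square power3_eq_cube)
      have Dv: "D v = 4 * d\<^sup>2 * v\<^sup>2 * (v\<^sup>2 + d\<^sup>2 * (l\<^sup>2 + 1))"
        by (simp add: D_def \<open>d1 = 0\<close>)
      have "4 * d\<^sup>2 * v\<^sup>2 * (- k * v\<^sup>2 - d\<^sup>2 * (k - l)) =
          4 * d\<^sup>2 * v\<^sup>2 * (F * x powi (n + 1) * (v\<^sup>2 + d\<^sup>2 * (l\<^sup>2 + 1)))"
        using eq[of v] v(1) unfolding Nv Dv \<open>w v = x\<close> by (simp only: ac_simps)
      then have "- k * v\<^sup>2 - d\<^sup>2 * (k - l) = F * x powi (n + 1) * (v\<^sup>2 + d\<^sup>2 * (l\<^sup>2 + 1))"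
        using v(1) d by (subst (asm) mult_cancel_left) simp
      then show "- k * x\<^sup>2 + d\<^sup>2 * l = F * x powi (n + 1) * (x\<^sup>2 + d\<^sup>2 * l\<^sup>2)"
        unfolding v(2) by (simp add: algebra_simps)
    qed
    then show ?thesis using \<open>d1 = 0\<close> by auto
  qed
qed

section \<open>The moving frame, regularity of the striction line, and the invariants\<close>

locale skew_ruled_surface =
  fixes I :: "real set" and s e :: "real \<Rightarrow> real^3"
  assumes skew: "skew_ruled_C3 I s e"
begin

abbreviation "e\<^sub>1 \<equiv> vderiv e"
abbreviation "e\<^sub>2 \<equiv> vderiv e\<^sub>1"
abbreviation "s\<^sub>1 \<equiv> vderiv s"
abbreviation "s\<^sub>2 \<equiv> vderiv s\<^sub>1"
text \<open>The central tangent vector, completing \<open>e\<close> and the central normal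
  \<open>e\<^sub>1\<close> to the orthonormal moving frame.\<close>

abbreviation "z u \<equiv> cross3 (e u) (e\<^sub>1 u)"
abbreviation "\<delta> \<equiv> dist_param s e"
abbreviation "\<kappa> \<equiv> con_curv e"
abbreviation "\<Lambda> \<equiv> lam s e"

lemma open_I: "open I" and is_interval_I: "is_interval I"
  using skew by (auto simp: skew_ruled_C3_def open_interval_def)

lemma e_deriv: "u \<in> I \<Longrightarrow> (e has_vector_derivative e\<^sub>1 u) (at u)"
  and e1_deriv: "u \<in> I \<Longrightarrow> (e\<^sub>1 has_vector_derivative e\<^sub>2 u) (at u)"
  and e2_deriv: "u \<in> I \<Longrightarrow> (e\<^sub>2 has_vector_derivative vderiv e\<^sub>2 u) (at u)"
  and s_deriv: "u \<in> I \<Longrightarrow> (s has_vector_derivative s\<^sub>1 u) (at u)"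
  using skew by (auto simp: skew_ruled_C3_def ruled_C3_def numeral_3_eq_3 vector_derivative_works)

lemma e_dot_e: "u \<in> I \<Longrightarrow> e u \<bullet> e u = 1"
  and e1_dot_e1: "u \<in> I \<Longrightarrow> e\<^sub>1 u \<bullet> e\<^sub>1 u = 1"
  and s1_dot_e1: "u \<in> I \<Longrightarrow> s\<^sub>1 u \<bullet> e\<^sub>1 u = 0"
  and delta_nonzero: "u \<in> I \<Longrightarrow> \<delta> u \<noteq> 0"
  using skew by (auto simp: skew_ruled_C3_def norm_eq_1)

lemma e_dot_e1: assumes u: "u \<in> I" shows "e u \<bullet> e\<^sub>1 u = 0"
  using inner_deriv_const[OF open_I u e_dot_e e_deriv[OF u] e_deriv[OF u]] by (simp add: inner_commute)

lemma e1_dot_e2: assumes u: "u \<in> I" shows "e\<^sub>2 u \<bullet> e\<^sub>1 u = 0"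
  using inner_deriv_const[OF open_I u e1_dot_e1 e1_deriv[OF u] e1_deriv[OF u]] by (simp add: inner_commute)

lemma e_dot_e2: assumes u: "u \<in> I" shows "e\<^sub>2 u \<bullet> e u = - 1"
  using inner_deriv_const[OF open_I u e_dot_e1 e_deriv[OF u] e1_deriv[OF u]] e1_dot_e1[OF u]
  by (simp add: inner_commute)

text \<open>A \<open>C\<^sup>3\<close> directrix \<open>r\<close> is \<open>s + m e\<close> with \<open>m = r' \<bullet> e'\<close>, because
  \<open>s' \<bullet> e' = 0\<close>; so \<open>s = r - m e\<close> is of class \<open>C\<^sup>2\<close>.\<close>

lemma directrix:
  obtains r where "Ck_on 3 r I" "\<And>u. u \<in> I \<Longrightarrow> s u = r u - (vderiv r u \<bullet> e\<^sub>1 u) *\<^sub>R e u"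
proof -
  obtain r where r: "Ck_on 3 r I" "\<And>u. u \<in> I \<Longrightarrow> \<exists>m. r u = s u + m *\<^sub>R e u"
    using skew by (auto simp: skew_ruled_C3_def ruled_C3_def)
  define m where "m u = (r u - s u) \<bullet> e u" for u
  have rm: "r u = s u + m u *\<^sub>R e u" if "u \<in> I" for u
    using r(2)[OF that] e_dot_e[OF that] by (auto simp: m_def inner_add_left)
  have "m u = vderiv r u \<bullet> e\<^sub>1 u" if u: "u \<in> I" for u
  proof -
    have rd: "(r has_vector_derivative vderiv r u) (at u)"
      using r(1) u by (auto simp: numeral_3_eq_3 vector_derivative_works)
    have "((\<lambda>t. r t - s t) has_vector_derivative (vderiv r u - s\<^sub>1 u)) (at u)"
      by (intro has_vector_derivative_diff rd s_deriv u)
    moreover have "(r t - s t) \<bullet> e\<^sub>1 t = 0" if "t \<in> I" for t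
      using rm[OF that] e_dot_e1[OF that] by simp
    ultimately have "(r u - s u) \<bullet> e\<^sub>2 u + (vderiv r u - s\<^sub>1 u) \<bullet> e\<^sub>1 u = 0"
      by (intro inner_deriv_const[OF open_I u, of "\<lambda>t. r t - s t" e\<^sub>1 0] e1_deriv[OF u])
    then show ?thesis
      using rm[OF u] e_dot_e2[OF u] s1_dot_e1[OF u] by (simp add: inner_diff_left inner_diff_right inner_commute)
  qed
  then have "s u = r u - (vderiv r u \<bullet> e\<^sub>1 u) *\<^sub>R e u" if "u \<in> I" for u
    using rm[OF that] that by simp
  with r(1) show ?thesis by (rule that)
qed

lemma C3_directrix:
  assumes "Ck_on 3 r I" "u \<in> I"
  shows "(r has_vector_derivative vderiv r u) (at u)"
    "(vderiv r has_vector_derivative vderiv (vderiv r) u) (at u)"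
    "(vderiv (vderiv r) has_vector_derivative vderiv (vderiv (vderiv r)) u) (at u)"
  using assms by (auto simp: numeral_3_eq_3 vector_derivative_works)

text \<open>This form of \<open>s\<^sub>1\<close> contains derivatives of \<open>r\<close> and
  \<open>e\<close> of order at most two, so it can be differentiated once more.\<close>

lemma directrix_deriv:
  obtains r where "Ck_on 3 r I"
    "\<And>u. u \<in> I \<Longrightarrow> s\<^sub>1 u = vderiv r u - ((vderiv r u \<bullet> e\<^sub>1 u) *\<^sub>R e\<^sub>1 u +
      (vderiv r u \<bullet> e\<^sub>2 u + vderiv (vderiv r) u \<bullet> e\<^sub>1 u) *\<^sub>R e u)"
proof -
  obtain r where r: "Ck_on 3 r I" and s_eq: "\<And>t. t \<in> I \<Longrightarrow> s t = r t - (vderiv r t \<bullet> e\<^sub>1 t) *\<^sub>R e t"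
    using directrix by blast
  note [derivative_intros] = bounded_bilinear.has_vector_derivative[OF bounded_bilinear_inner]
    bounded_bilinear.has_vector_derivative[OF bounded_bilinear_scaleR]
  let ?s1 = "\<lambda>t. vderiv r t - ((vderiv r t \<bullet> e\<^sub>1 t) *\<^sub>R e\<^sub>1 t +
      (vderiv r t \<bullet> e\<^sub>2 t + vderiv (vderiv r) t \<bullet> e\<^sub>1 t) *\<^sub>R e t)"
  have "s\<^sub>1 t = ?s1 t" if t: "t \<in> I" for t
  proof -
    have "((\<lambda>t. r t - (vderiv r t \<bullet> e\<^sub>1 t) *\<^sub>R e t) has_vector_derivative ?s1 t) (at t)"
      by (intro derivative_intros C3_directrix[OF r] e_deriv e1_deriv t)
    then have "(s has_vector_derivative ?s1 t) (at t)"
      by (rule has_vector_derivative_transform_within_open[OF _ open_I t]) (simp add: s_eq)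
    then show ?thesis by (rule vector_derivative_at)
  qed
  with r show ?thesis by (rule that)
qed

lemma s1_deriv: assumes u: "u \<in> I" shows "(s\<^sub>1 has_vector_derivative s\<^sub>2 u) (at u)"
proof -
  obtain r where r: "Ck_on 3 r I"
    and s1: "\<And>t. t \<in> I \<Longrightarrow> s\<^sub>1 t = vderiv r t - ((vderiv r t \<bullet> e\<^sub>1 t) *\<^sub>R e\<^sub>1 t +
      (vderiv r t \<bullet> e\<^sub>2 t + vderiv (vderiv r) t \<bullet> e\<^sub>1 t) *\<^sub>R e t)"
    using directrix_deriv by blast
  let ?s1 = "\<lambda>t. vderiv r t - ((vderiv r t \<bullet> e\<^sub>1 t) *\<^sub>R e\<^sub>1 t +
      (vderiv r t \<bullet> e\<^sub>2 t + vderiv (vderiv r) t \<bullet> e\<^sub>1 t) *\<^sub>R e t)"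
  note vd_inner = bounded_bilinear.has_vector_derivative[OF bounded_bilinear_inner]
  note vd_scaleR = bounded_bilinear.has_vector_derivative[OF bounded_bilinear_scaleR]
  note rd = C3_directrix[OF r]
  \<comment> \<open>Existence of some derivative is enough, since \<open>s\<^sub>2\<close> denotes
    the vector derivative of \<open>s\<^sub>1\<close>.\<close>
  have "\<exists>D. (?s1 has_vector_derivative D) (at u)"
    by (rule exI, rule has_vector_derivative_diff[OF rd(2)[OF u] has_vector_derivative_add[OF
          vd_scaleR[OF vd_inner[OF rd(2)[OF u] e1_deriv[OF u]] e1_deriv[OF u]]
          vd_scaleR[OF has_vector_derivative_add[OF vd_inner[OF rd(2)[OF u] e2_deriv[OF u]]
            vd_inner[OF rd(3)[OF u] e1_deriv[OF u]]] e_deriv[OF u]]]])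
  then obtain D where "(?s1 has_vector_derivative D) (at u)" ..
  then have "(s\<^sub>1 has_vector_derivative D) (at u)"
    by (rule has_vector_derivative_transform_within_open[OF _ open_I u]) (simp add: s1)
  then show ?thesis using vector_derivative_at by metis
qed

lemma continuous_on_frame:
  "continuous_on I e" "continuous_on I e\<^sub>1" "continuous_on I e\<^sub>2" "continuous_on I s\<^sub>1"
  by (rule continuous_on_vector_derivative, rule has_vector_derivative_at_within,
      erule e_deriv e1_deriv e2_deriv s1_deriv)+

text \<open>Passing to the directrix \<open>r\<close> does not change the parameter of distribution and makes it
  visibly of class \<open>C\<^sup>1\<close>.\<close>

lemma delta_C1:
  "(\<forall>u\<in>I. (\<delta> has_real_derivative deriv \<delta> u) (at u)) \<and> continuous_on I (deriv \<delta>)"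
proof -
  obtain r where r: "Ck_on 3 r I"
    and s1: "\<And>t. t \<in> I \<Longrightarrow> s\<^sub>1 t = vderiv r t - ((vderiv r t \<bullet> e\<^sub>1 t) *\<^sub>R e\<^sub>1 t +
      (vderiv r t \<bullet> e\<^sub>2 t + vderiv (vderiv r) t \<bullet> e\<^sub>1 t) *\<^sub>R e t)"
    using directrix_deriv by blast
  let ?r1 = "vderiv r" let ?r2 = "vderiv ?r1"
  note rd = C3_directrix[OF r]
  note [derivative_intros] = bounded_bilinear.has_vector_derivative[OF bounded_bilinear_inner]
    bounded_bilinear.has_vector_derivative[OF bounded_bilinear_cross3]
  have eq: "\<delta> t = z t \<bullet> ?r1 t" if t: "t \<in> I" for t
  proof -
    have "\<delta> t = z t \<bullet> s\<^sub>1 t"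
      unfolding dist_param_def triple_def by (metis cross_triple inner_commute)
    \<comment> \<open>The terms by which \<open>s\<^sub>1\<close> differs from
      \<open>vderiv r\<close> lie in the span of \<open>e\<close> and \<open>e\<^sub>1\<close>,
      which is orthogonal to \<open>z\<close>.\<close>
    then show ?thesis by (simp add: s1[OF t] inner_diff_right inner_add_right dot_cross_self)
  qed
  let ?d = "\<lambda>t. z t \<bullet> ?r2 t + (cross3 (e t) (e\<^sub>2 t) + cross3 (e\<^sub>1 t) (e\<^sub>1 t)) \<bullet> ?r1 t"
  have D: "(\<delta> has_real_derivative ?d u) (at u)" if u: "u \<in> I" for u
  proof -
    have "((\<lambda>t. z t \<bullet> ?r1 t) has_vector_derivative ?d u) (at u)"
      by (intro derivative_intros rd e_deriv e1_deriv u)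
    then have "(\<delta> has_vector_derivative ?d u) (at u)"
      by (rule has_vector_derivative_transform_within_open[OF _ open_I u]) (simp add: eq)
    then show ?thesis by (simp add: has_real_derivative_iff_has_vector_derivative)
  qed
  have "continuous_on I ?r1" "continuous_on I ?r2"
    by (rule continuous_on_vector_derivative, rule has_vector_derivative_at_within, erule rd)+
  then have "continuous_on I ?d" by (intro continuous_intros continuous_on_cross continuous_on_frame)
  moreover have "deriv \<delta> u = ?d u" if "u \<in> I" for u
    using D[OF that] by (rule DERIV_imp_deriv)
  ultimately show ?thesis using D by (simp cong: continuous_on_cong)
qed

lemma delta_deriv: "u \<in> I \<Longrightarrow> (\<delta> has_real_derivative deriv \<delta> u) (at u)"
  and continuous_deriv_delta: "continuous_on I (deriv \<delta>)"
  using delta_C1 by auto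

lemma continuous_delta: "continuous_on I \<delta>"
  by (meson DERIV_isCont continuous_at_imp_continuous_on delta_deriv)

lemma frame:
  assumes u: "u \<in> I"
  shows "e u \<bullet> z u = 0" "z u \<bullet> e u = 0" "e\<^sub>1 u \<bullet> z u = 0" "z u \<bullet> e\<^sub>1 u = 0" "z u \<bullet> z u = 1"
    "e\<^sub>1 u \<bullet> e u = 0" "cross3 (z u) (e u) = e\<^sub>1 u" "cross3 (e\<^sub>1 u) (e u) = - z u"
  using e_dot_e[OF u] e1_dot_e1[OF u] e_dot_e1[OF u] cross_skew[of "e\<^sub>1 u" "e u"]
    cross_skew[of "z u" "e u"]
  by (auto simp: dot_cross_self dot_cross Lagrange inner_commute)

lemma delta_eq: "\<delta> u = s\<^sub>1 u \<bullet> z u"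
  unfolding dist_param_def triple_def
  by (metis cross_triple inner_commute)

lemma kappa_eq: "\<kappa> u = e\<^sub>2 u \<bullet> z u"
  unfolding con_curv_def triple_def
  by (metis cross_triple inner_commute)

text \<open>Translates the angle into frame components. As \<open>s\<^sub>1\<close> has components
  \<open>p\<close> along \<open>e\<close> and \<open>\<delta>\<close> along \<open>z\<close>, the
  unsigned angle has cosine \<open>p / r\<close> and sine \<open>\<bar>\<delta> u\<bar> / r\<close>,
  hence cotangent \<open>p / \<bar>\<delta> u\<bar>\<close>. The sign in \<open>striction\<close>
  removes the absolute value because the cotangent is odd.\<close>

lemma lam_eq: assumes u: "u \<in> I" shows "s\<^sub>1 u \<bullet> e u = \<delta> u * \<Lambda> u"
proof -
  define p where "p = s\<^sub>1 u \<bullet> e u"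
  define r where "r = sqrt (p\<^sup>2 + (\<delta> u)\<^sup>2)"
  have pos: "p\<^sup>2 + (\<delta> u)\<^sup>2 > 0" using delta_nonzero[OF u] by (auto intro!: add_nonneg_pos)
  have s1: "s\<^sub>1 u = p *\<^sub>R e u + \<delta> u *\<^sub>R z u"
    using cross3_expansion_orthonormal[OF e_dot_e[OF u] e1_dot_e1[OF u] e_dot_e1[OF u], of "s\<^sub>1 u"]
    by (simp add: s1_dot_e1[OF u] p_def delta_eq)
  have "s\<^sub>1 u \<bullet> s\<^sub>1 u = p\<^sup>2 + (\<delta> u)\<^sup>2"
    by (simp add: s1 inner_add_left inner_add_right frame[OF u] e_dot_e[OF u] power2_eq_square)
  then have n: "norm (s\<^sub>1 u) = r" by (simp add: norm_eq_sqrt_inner r_def)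
  have r: "r > 0" "r\<^sup>2 = p\<^sup>2 + (\<delta> u)\<^sup>2" using pos by (auto simp: r_def)
  have "1 - (p / r)\<^sup>2 = (r\<^sup>2 - p\<^sup>2) / r\<^sup>2"
    using r(1) by (simp add: power_divide diff_divide_distrib)
  then have 1: "1 - (p / r)\<^sup>2 = (\<bar>\<delta> u\<bar> / r)\<^sup>2"
    by (simp add: r(2) power_divide)
  then have "(p / r)\<^sup>2 < 1" using r delta_nonzero[OF u]
    by (smt (verit) divide_eq_0_iff zero_less_power2 abs_eq_0)
  then have "\<bar>p / r\<bar> < 1" by (simp add: abs_square_less_1)
  then have "cot (arccos (p / r)) = p / r / (\<bar>\<delta> u\<bar> / r)"
    using r by (simp add: cot_arccos 1 real_sqrt_abs)
  also have "\<dots> = p / \<bar>\<delta> u\<bar>" using r by simp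
  finally have "cot (arccos (p / r)) = p / \<bar>\<delta> u\<bar>" .
  moreover have "vec_angle (e u) (s\<^sub>1 u) = arccos (p / r)"
    using e_dot_e[OF u] by (simp add: vec_angle_def n p_def inner_commute norm_eq_1[symmetric])
  ultimately have "\<Lambda> u = p / \<delta> u"
    using delta_nonzero[OF u]
    by (cases "\<delta> u > 0") (auto simp: lam_def striction_def sgn_real_def cot_def)
  then show ?thesis using delta_nonzero[OF u] by (simp add: p_def)
qed

lemma continuous_kappa: "continuous_on I \<kappa>"
  unfolding kappa_eq[abs_def] by (intro continuous_intros continuous_on_cross continuous_on_frame)

lemma continuous_lam: "continuous_on I \<Lambda>"
proof -
  have "continuous_on I (\<lambda>u. s\<^sub>1 u \<bullet> e u / \<delta> u)"
    using delta_nonzero by (intro continuous_intros continuous_delta continuous_on_frame) auto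
  then show ?thesis
    by (rule continuous_on_eq) (use lam_eq delta_nonzero in auto)
qed

lemma s1_expansion: "u \<in> I \<Longrightarrow> s\<^sub>1 u = (\<delta> u * \<Lambda> u) *\<^sub>R e u + \<delta> u *\<^sub>R z u"
  using cross3_expansion_orthonormal[OF e_dot_e e1_dot_e1 e_dot_e1, of u "s\<^sub>1 u"]
  by (simp add: s1_dot_e1 lam_eq delta_eq)

lemma e2_expansion: "u \<in> I \<Longrightarrow> e\<^sub>2 u = - e u + \<kappa> u *\<^sub>R z u"
  using cross3_expansion_orthonormal[OF e_dot_e e1_dot_e1 e_dot_e1, of u "e\<^sub>2 u"]
  by (simp add: e_dot_e2 e1_dot_e2 kappa_eq)

text \<open>Differentiating \<open>s\<^sub>1 \<bullet> e\<^sub>1 = 0\<close> moves the derivative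
  onto \<open>e\<^sub>1\<close>, where both factors have known expansions.\<close>

lemma s2_dot_e1: assumes u: "u \<in> I" shows "s\<^sub>2 u \<bullet> e\<^sub>1 u = \<delta> u * \<Lambda> u - \<kappa> u * \<delta> u"
  using inner_deriv_const[OF open_I u s1_dot_e1 s1_deriv[OF u] e1_deriv[OF u]]
  by (simp add: s1_expansion[OF u] e2_expansion[OF u] inner_add_left inner_add_right frame[OF u]
      inner_diff_right e_dot_e[OF u] algebra_simps)

text \<open>In the derivative of \<delta> = \<open>s\<^sub>1 \<bullet> z\<close> the term with z'
  drops out, since z' is \<open>- \<kappa>\<close> times \<open>e\<^sub>1\<close> and
  \<open>s\<^sub>1\<close> is orthogonal to \<open>e\<^sub>1\<close>.\<close>

lemma s2_dot_z: assumes u: "u \<in> I" shows "s\<^sub>2 u \<bullet> z u = deriv \<delta> u"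
proof -
  have "(z has_vector_derivative (cross3 (e u) (e\<^sub>2 u) + cross3 (e\<^sub>1 u) (e\<^sub>1 u))) (at u)"
    by (rule bounded_bilinear.has_vector_derivative[OF bounded_bilinear_cross3 e_deriv[OF u] e1_deriv[OF u]])
  then have "((\<lambda>u. s\<^sub>1 u \<bullet> z u) has_vector_derivative (s\<^sub>1 u \<bullet> (cross3 (e u) (e\<^sub>2 u) + cross3 (e\<^sub>1 u) (e\<^sub>1 u)) + s\<^sub>2 u \<bullet> z u)) (at u)"
    by (rule bounded_bilinear.has_vector_derivative[OF bounded_bilinear_inner s1_deriv[OF u]])
  moreover have "cross3 (e u) (e\<^sub>2 u) = - \<kappa> u *\<^sub>R e\<^sub>1 u"
    using frame[OF u] cross_skew[of "e u" "z u"]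
    by (simp add: e2_expansion[OF u] cross_add_right cross_mult_right Cross3.right_diff_distrib)
  ultimately have "(\<delta> has_vector_derivative s\<^sub>2 u \<bullet> z u) (at u)"
    using s1_dot_e1[OF u] by (simp add: delta_eq[abs_def])
  then show ?thesis
    by (simp add: has_real_derivative_iff_has_vector_derivative[symmetric] DERIV_imp_deriv)
qed

section \<open>Partial derivatives, fundamental forms and curvatures of the ruled surface\<close>

lemma pd_v_ruled: "pd_v (ruled s e) u v = e u"
proof -
  have "((\<lambda>t. s u + t *\<^sub>R e u) has_vector_derivative e u) (at v)"
    by (auto intro!: derivative_eq_intros)
  then show ?thesis by (simp add: pd_v_def ruled_def vector_derivative_at)
qed

lemma ruled_deriv:
  "u \<in> I \<Longrightarrow> ((\<lambda>t. ruled s e t v) has_vector_derivative s\<^sub>1 u + v *\<^sub>R e\<^sub>1 u) (at u)"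
  unfolding ruled_def by (auto intro!: derivative_eq_intros s_deriv e_deriv)

lemma ruled_deriv2:
  "u \<in> I \<Longrightarrow> ((\<lambda>t. s\<^sub>1 t + v *\<^sub>R e\<^sub>1 t) has_vector_derivative s\<^sub>2 u + v *\<^sub>R e\<^sub>2 u) (at u)"
  by (auto intro!: derivative_eq_intros s1_deriv e1_deriv)

lemma pd_u_ruled: "u \<in> I \<Longrightarrow> pd_u (ruled s e) u v = s\<^sub>1 u + v *\<^sub>R e\<^sub>1 u"
  by (simp add: pd_u_def vector_derivative_at[OF ruled_deriv])

lemma pd_uu_ruled: assumes u: "u \<in> I" shows "pd_u (pd_u (ruled s e)) u v = s\<^sub>2 u + v *\<^sub>R e\<^sub>2 u"
proof -
  have "((\<lambda>t. pd_u (ruled s e) t v) has_vector_derivative s\<^sub>2 u + v *\<^sub>R e\<^sub>2 u) (at u)"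
    by (rule has_vector_derivative_transform_within_open[OF ruled_deriv2[OF u] open_I u])
      (simp add: pd_u_ruled)
  then show ?thesis unfolding pd_u_def[of "pd_u (ruled s e)"] by (rule vector_derivative_at)
qed

lemma pd_vu_ruled: assumes u: "u \<in> I" shows "pd_v (pd_u (ruled s e)) u v = e\<^sub>1 u"
proof -
  have "((\<lambda>t. s\<^sub>1 u + t *\<^sub>R e\<^sub>1 u) has_vector_derivative e\<^sub>1 u) (at v)"
    by (auto intro!: derivative_eq_intros)
  then show ?thesis
    unfolding pd_v_def[of "pd_u (ruled s e)"] pd_u_ruled[OF u] by (rule vector_derivative_at)
qed

lemma pd_vv_ruled: "pd_v (pd_v (ruled s e)) u v = 0"
  unfolding pd_v_def[of "pd_v (ruled s e)"] pd_v_ruled by simp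

lemma unit_normal_ruled:
  assumes u: "u \<in> I"
  shows "unit_normal (ruled s e) u v = (1 / sqrt (v\<^sup>2 + (\<delta> u)\<^sup>2)) *\<^sub>R (\<delta> u *\<^sub>R e\<^sub>1 u - v *\<^sub>R z u)"
proof -
  let ?N = "\<delta> u *\<^sub>R e\<^sub>1 u - v *\<^sub>R z u"
  have N: "cross3 (pd_u (ruled s e) u v) (pd_v (ruled s e) u v) = ?N"
    by (simp add: pd_u_ruled[OF u] pd_v_ruled s1_expansion[OF u] cross_add_left cross_mult_left frame[OF u])
  have "norm ?N = sqrt (v\<^sup>2 + (\<delta> u)\<^sup>2)"
    by (simp add: norm_eq_sqrt_inner inner_diff_left inner_diff_right frame[OF u] e1_dot_e1[OF u] power2_eq_square add.commute)
  then show ?thesis by (simp add: unit_normal_def N sgn_div_norm divide_inverse)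
qed

lemma fundamental_forms:
  fixes v :: real
  assumes u: "u \<in> I"
  defines "w \<equiv> sqrt (v\<^sup>2 + (\<delta> u)\<^sup>2)"
  shows "ff_E (ruled s e) u v = v\<^sup>2 + (\<delta> u)\<^sup>2 * ((\<Lambda> u)\<^sup>2 + 1)"
    "ff_F (ruled s e) u v = \<delta> u * \<Lambda> u" "ff_G (ruled s e) u v = 1"
    "ff_L (ruled s e) u v = - (\<kappa> u * v\<^sup>2 + deriv \<delta> u * v + (\<delta> u)\<^sup>2 * (\<kappa> u - \<Lambda> u)) / w"
    "ff_M (ruled s e) u v = \<delta> u / w" "ff_N (ruled s e) u v = 0"
proof -
  note f = frame[OF u] e_dot_e[OF u] e1_dot_e1[OF u] e_dot_e1[OF u]
  note i = inner_add_left inner_add_right inner_diff_right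
  show "ff_E (ruled s e) u v = v\<^sup>2 + (\<delta> u)\<^sup>2 * ((\<Lambda> u)\<^sup>2 + 1)"
    by (simp add: ff_E_def pd_u_ruled[OF u] s1_expansion[OF u] i f power2_eq_square algebra_simps)
  show "ff_F (ruled s e) u v = \<delta> u * \<Lambda> u"
    by (simp add: ff_F_def pd_u_ruled[OF u] pd_v_ruled s1_expansion[OF u] i f)
  show "ff_G (ruled s e) u v = 1" by (simp add: ff_G_def pd_v_ruled f)
  show "ff_L (ruled s e) u v = - (\<kappa> u * v\<^sup>2 + deriv \<delta> u * v + (\<delta> u)\<^sup>2 * (\<kappa> u - \<Lambda> u)) / w"
  proof -
    \<comment> \<open>The component of \<open>s\<^sub>2\<close> along \<open>e\<^sub>1\<close> gives
      the constant term in \<open>v\<close>, its component along \<open>z\<close> the linear term,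
      and \<open>e\<^sub>2 \<bullet> z = \<kappa>\<close> the quadratic one.\<close>
    have "(s\<^sub>2 u + v *\<^sub>R e\<^sub>2 u) \<bullet> (\<delta> u *\<^sub>R e\<^sub>1 u - v *\<^sub>R z u) =
        - (\<kappa> u * v\<^sup>2 + deriv \<delta> u * v + (\<delta> u)\<^sup>2 * (\<kappa> u - \<Lambda> u))"
      by (simp add: i s2_dot_e1[OF u] s2_dot_z[OF u] e1_dot_e2[OF u] kappa_eq[symmetric]
          power2_eq_square algebra_simps)
    then show ?thesis
      by (simp only: ff_L_def pd_uu_ruled[OF u] unit_normal_ruled[OF u] w_def inner_scaleR_right) simp
  qed
  show "ff_M (ruled s e) u v = \<delta> u / w"
    unfolding w_def by (simp add: ff_M_def pd_vu_ruled[OF u] unit_normal_ruled[OF u] i f)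
  show "ff_N (ruled s e) u v = 0" by (simp add: ff_N_def pd_vv_ruled)
qed

lemma normal_curvature_ruled:
  assumes "u \<in> I"
  shows "normal_curvature (ruled s e) u v 1 q =
    (- (\<kappa> u * v\<^sup>2 + deriv \<delta> u * v + (\<delta> u)\<^sup>2 * (\<kappa> u - \<Lambda> u)) + 2 * \<delta> u * q) / sqrt (v\<^sup>2 + (\<delta> u)\<^sup>2) /
    (v\<^sup>2 + (\<delta> u)\<^sup>2 * ((\<Lambda> u)\<^sup>2 + 1) + 2 * (\<delta> u * \<Lambda> u) * q + q\<^sup>2)"
  unfolding normal_curvature_def fundamental_forms[OF assms]
  by (simp add: add_divide_distrib diff_divide_distrib)

text \<open>Since the coefficient \<open>ff_N\<close> vanishes, the numerator is minus the square of
  \<open>ff_M\<close>, and EG - F^2 equals w^2.\<close>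

lemma gauss_curvature_ruled:
  assumes u: "u \<in> I"
  shows "gauss_curvature (ruled s e) u v = - ((\<delta> u)\<^sup>2 / (v\<^sup>2 + (\<delta> u)\<^sup>2)\<^sup>2)"
proof -
  have "v\<^sup>2 + (\<delta> u)\<^sup>2 > 0" using delta_nonzero[OF u] by (auto intro!: add_nonneg_pos)
  moreover have "v\<^sup>2 + (\<delta> u)\<^sup>2 * ((\<Lambda> u)\<^sup>2 + 1) - (\<delta> u * \<Lambda> u)\<^sup>2 = v\<^sup>2 + (\<delta> u)\<^sup>2"
    by (simp add: algebra_simps power_mult_distrib)
  ultimately show ?thesis
    unfolding gauss_curvature_def fundamental_forms[OF u]
    by (simp add: power_divide power2_eq_square)
qed

section \<open>Curves of constant Gaussian curvature\<close>

text \<open>Lets the curvature hypothesis be applied at every point off the striction line: the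
  curve is an explicit graph over \<open>u\<close>, and its slope at the point is read off by
  differentiation.\<close>

lemma constant_curvature_curve_through:
  assumes u0: "u0 \<in> I" and v0: "v0 \<noteq> 0"
  obtains J c where "constant_curvature_curve (ruled s e) I J c" "u0 \<in> J" "c u0 = (u0, v0)"
    "vderiv c u0 = (1, deriv \<delta> u0 * (v0\<^sup>2 - (\<delta> u0)\<^sup>2) / (2 * \<delta> u0 * v0))"
proof -
  let ?d0 = "\<delta> u0"
  define W where "W = v0\<^sup>2 + ?d0\<^sup>2"
  \<comment> \<open>Constancy of K is ensured by constancy of \<delta> / (v^2 + \<delta>^2); solving
    for v^2, with the constant fixed by the given point, yields \<open>h\<close>.\<close>
  define h where "h t = \<delta> t * W / ?d0 - (\<delta> t)\<^sup>2" for t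
  define h' where "h' t = deriv \<delta> t * (W / ?d0 - 2 * \<delta> t)" for t
  define g where "g t = sgn v0 * sqrt (h t)" for t
  define g' where "g' t = sgn v0 * (h' t / (2 * sqrt (h t)))" for t
  have d0: "?d0 \<noteq> 0" using u0 by (rule delta_nonzero)
  have W: "W > 0" using v0 by (auto simp: W_def intro!: add_pos_nonneg)
  have h0: "h u0 = v0\<^sup>2" using d0 by (simp add: h_def W_def)
  have hc: "continuous_on I h" unfolding h_def using d0 by (intro continuous_intros continuous_delta) auto
  \<comment> \<open>Near \<open>u0\<close> the function \<open>h\<close> stays positive, so its
    square root is continuously differentiable; the sign of \<open>v0\<close> selects the branch
    through the given point.\<close>
  have "open (h -` {0<..} \<inter> I)"
    using hc open_I by (simp add: continuous_on_open_vimage)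
  moreover have "u0 \<in> h -` {0<..} \<inter> I" using u0 v0 by (simp add: h0)
  ultimately obtain r where r: "r > 0" "ball u0 r \<subseteq> h -` {0<..} \<inter> I"
    by (meson openE)
  define J where "J = ball u0 r"
  have J: "t \<in> I" "h t > 0" if "t \<in> J" for t using r(2) that by (auto simp: J_def)
  have JI: "J \<subseteq> I" using J by auto
  have hd: "(h has_real_derivative h' t) (at t)" if "t \<in> J" for t
    unfolding h_def h'_def
    by (rule derivative_eq_intros delta_deriv[OF J(1)[OF that]] refl | simp add: d0 field_simps)+
  have gd: "(g has_real_derivative g' t) (at t)" if "t \<in> J" for t
  proof -
    have "((\<lambda>t. sgn v0 * sqrt (h t)) has_real_derivative
        sgn v0 * (inverse (sqrt (h t)) / 2 * h' t)) (at t)"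
      by (rule DERIV_cmult, rule DERIV_chain2[where f = sqrt and g = h, OF DERIV_real_sqrt hd])
        (use J(2) that in auto)
    moreover have "sgn v0 * (inverse (sqrt (h t)) / 2 * h' t) = g' t"
      unfolding g'_def by (simp only: divide_inverse inverse_mult_distrib mult_ac)
    moreover have "g = (\<lambda>t. sgn v0 * sqrt (h t))" by (rule ext) (rule g_def)
    ultimately show ?thesis by (simp only:)
  qed
  define c where "c t = (t, g t)" for t
  have cd: "(c has_vector_derivative (1, g' t)) (at t)" if "t \<in> J" for t
    unfolding c_def using gd[OF that]
    by (intro has_vector_derivative_Pair has_vector_derivative_id)
      (simp add: has_real_derivative_iff_has_vector_derivative)
  have c': "vderiv c t = (1, g' t)" if "t \<in> J" for t using cd[OF that] by (rule vector_derivative_at)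
  have "continuous_on J g'"
    unfolding g'_def h'_def using J d0
    by (intro continuous_intros continuous_on_subset[OF hc JI] continuous_on_subset[OF continuous_delta JI]
        continuous_on_subset[OF continuous_deriv_delta JI]) force+
  then have "continuous_on J (\<lambda>t. (1, g' t) :: real \<times> real)" by (intro continuous_intros)
  then have "continuous_on J (vderiv c)" by (simp add: c' cong: continuous_on_cong)
  moreover have "c differentiable (at t)" if "t \<in> J" for t
    using cd[OF that] by (rule differentiableI_vector)
  ultimately have "Ck_on 1 c J" by simp
  moreover have "gauss_curvature (ruled s e) (fst (c t)) (snd (c t)) = - (?d0\<^sup>2 / W\<^sup>2)" if "t \<in> J" for t
  proof -
    have "(g t)\<^sup>2 + (\<delta> t)\<^sup>2 = \<delta> t * W / ?d0"
      using v0 J[OF that] by (simp add: g_def power_mult_distrib sgn_real_def h_def)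
    then show ?thesis
      using J[OF that] W d0 delta_nonzero[of t]
      by (simp add: c_def gauss_curvature_ruled power_divide power_mult_distrib)
  qed
  then have "(\<lambda>t. gauss_curvature (ruled s e) (fst (c t)) (snd (c t))) constant_on J"
    by (auto simp: constant_on_def)
  moreover have "open_interval J"
    using r(1) by (auto simp: open_interval_def J_def is_interval_ball_real)
  moreover have "u0 \<in> J" using r(1) by (simp add: J_def)
  moreover have "fst (c t) \<in> I" "vderiv c t \<noteq> 0" if "t \<in> J" for t
    using that J c' by (auto simp: c_def zero_prod_def)
  moreover have "c u0 = (u0, v0)" by (simp add: c_def g_def h0 sgn_mult_abs)
  moreover have "g' u0 = deriv \<delta> u0 * (v0\<^sup>2 - ?d0\<^sup>2) / (2 * ?d0 * v0)"
  proof -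
    have "g' u0 = h' u0 / (2 * v0)" 
      using v0 by (cases "v0 > 0") (auto simp: g'_def h0)
    also have "h' u0 = deriv \<delta> u0 * (v0\<^sup>2 - ?d0\<^sup>2) / ?d0"
      using d0 by (simp add: h'_def W_def field_simps power2_eq_square)
    finally show ?thesis by simp
  qed
  ultimately show ?thesis
    using c'[of u0] by (intro that[of J c]) (auto simp: constant_curvature_curve_def)
qed

section \<open>The rotational osculating quadric\<close>

text \<open>If \<open>k\<close> and \<open>\<delta>\<close> are constant and \<open>\<lambda> = -1/k\<close>, the surface itself is a hyperboloid with
  axis along the Darboux vector \<open>k e + z\<close> and centre \<open>s - (\<delta>/k) e'\<close>; in general this
  hyperboloid still has contact of order two.\<close>

lemma rotational_osculating_quadric:
  assumes u: "u \<in> I" and kl: "\<kappa> u * \<Lambda> u = - 1" and d': "deriv \<delta> u = 0"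
  shows "\<exists>Q. osculating_quadric (ruled s e) u Q \<and> rotational_hyperboloid Q"
proof -
  define k where "k = \<kappa> u"
  define d where "d = k *\<^sub>R e u + z u"
  define m where "m = s u - (\<delta> u / k) *\<^sub>R e\<^sub>1 u"
  \<comment> \<open>This is the hyperboloid with semi-axes \<open>\<bar>\<delta> u / k\<bar>\<close>
    (twice) and \<open>\<bar>\<delta> u\<bar>\<close>, cleared of denominators; the axis vector is
    left with squared length \<open>k\<^sup>2 + 1\<close>.\<close>
  define q where "q X = k\<^sup>2 * ((X - m) \<bullet> (X - m)) - ((X - m) \<bullet> d)\<^sup>2 - (\<delta> u)\<^sup>2" for X
  have k: "k \<noteq> 0" using kl by (auto simp: k_def)
  have l: "\<Lambda> u = - 1 / k" using kl k by (simp add: k_def field_simps)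
  have d0: "\<delta> u \<noteq> 0" using u by (rule delta_nonzero)
  note f = frame[OF u] e_dot_e[OF u] e1_dot_e1[OF u] e_dot_e1[OF u]
  note i = inner_add_left inner_add_right inner_diff_right inner_diff_left
  have dd: "d \<bullet> d = k\<^sup>2 + 1" by (simp add: d_def i f power2_eq_square)
  have "quadratic_fun q"
  proof -
    define A :: "real^3^3" where "A = matrix (\<lambda>X. k\<^sup>2 *\<^sub>R X - (X \<bullet> d) *\<^sub>R d)"
    have "linear (\<lambda>X. k\<^sup>2 *\<^sub>R X - (X \<bullet> d) *\<^sub>R d)"
      by (rule linearI) (simp_all add: i algebra_simps)
    then have Av: "A *v X = k\<^sup>2 *\<^sub>R X - (X \<bullet> d) *\<^sub>R d" for X
      by (simp add: A_def matrix_works)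
    have "transpose A = A"
      by (simp add: A_def transpose_def matrix_def vec_eq_iff inner_axis') (simp add: axis_def)
    moreover have "A \<noteq> 0"
    proof
      assume "A = 0"
      \<comment> \<open>As \<open>e\<^sub>1\<close> is orthogonal to \<open>d\<close>, it is an
        eigenvector of \<open>A\<close> with the nonzero eigenvalue
        \<open>k\<^sup>2\<close>.\<close>
      then have "e\<^sub>1 u \<bullet> (A *v e\<^sub>1 u) = 0" by simp
      then show False using k by (simp add: Av d_def i f)
    qed
    moreover have "q X = X \<bullet> (A *v X) + (- 2 *\<^sub>R (A *v m)) \<bullet> X + (m \<bullet> (A *v m) - (\<delta> u)\<^sup>2)" for X
      by (simp add: q_def Av i power2_eq_square inner_commute algebra_simps)
    ultimately show ?thesis unfolding quadratic_fun_def by blast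
  qed
  moreover have "(deriv ^^ j) (\<lambda>t. q (ruled s e t v)) u = 0" if "j \<le> 2" for j v
  proof -
    define y where "y t = ruled s e t v - m" for t
    define y1 where "y1 t = s\<^sub>1 t + v *\<^sub>R e\<^sub>1 t" for t
    define y2 where "y2 = s\<^sub>2 u + v *\<^sub>R e\<^sub>2 u"
    \<comment> \<open>The first derivative of \<open>q\<close> along the curve of fixed
      \<open>v\<close>, with \<open>m\<close> and \<open>d\<close> frozen at
      \<open>u\<close>.\<close>
    define g1 where "g1 t = 2 * (k\<^sup>2 * (y t \<bullet> y1 t) - (y t \<bullet> d) * (y1 t \<bullet> d))" for t
    have yd: "(y has_vector_derivative y1 t) (at t)" if "t \<in> I" for t
      using has_vector_derivative_diff[OF ruled_deriv[OF that, of v] has_vector_derivative_const[of m]]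
      by (simp add: y_def[abs_def] y1_def)
    have y1d: "(y1 has_vector_derivative y2) (at u)"
      unfolding y1_def y2_def by (rule ruled_deriv2[OF u])
    have inner_d: "((\<lambda>t. a t \<bullet> b t) has_real_derivative a t \<bullet> b' + a' \<bullet> b t) (at t)"
      if "(a has_vector_derivative a') (at t)" "(b has_vector_derivative b') (at t)"
      for a b :: "real \<Rightarrow> real^3" and a' b' t
      using bounded_bilinear.has_vector_derivative[OF bounded_bilinear_inner that]
      by (simp add: has_real_derivative_iff_has_vector_derivative)
    have const_d: "((\<lambda>t. a t \<bullet> d) has_real_derivative a' \<bullet> d) (at t)"
      if "(a has_vector_derivative a') (at t)" for a :: "real \<Rightarrow> real^3" and a' t
      using inner_d[OF that has_vector_derivative_const[of d]] by simp
    have yu: "y u = (\<delta> u / k) *\<^sub>R e\<^sub>1 u + v *\<^sub>R e u" by (simp add: y_def ruled_def m_def)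
    have y1u: "y1 u = - (\<delta> u / k) *\<^sub>R e u + \<delta> u *\<^sub>R z u + v *\<^sub>R e\<^sub>1 u"
      by (simp add: y1_def s1_expansion[OF u] l)
    have y1d0: "y1 u \<bullet> d = 0" using k by (simp add: y1u d_def i f)
    have yy1: "y u \<bullet> y1 u = 0" by (simp add: yu y1u i f)
    have ydu: "y u \<bullet> d = v * k" by (simp add: yu d_def i f)
    \<comment> \<open>The component of \<open>s\<^sub>2\<close> along \<open>e\<close> is not
      expressed by the invariants at \<open>u\<close>; its two contributions to the second
      derivative of \<open>q\<close> cancel.\<close>
    define P where "P = s\<^sub>2 u \<bullet> e u"
    have y2d: "y2 \<bullet> d = k * P"
      by (simp add: y2_def d_def i f P_def s2_dot_z[OF u] d' e_dot_e2[OF u] kappa_eq[symmetric] k_def algebra_simps)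
    have yy2: "y u \<bullet> y2 = \<delta> u / k * (\<delta> u * \<Lambda> u - k * \<delta> u) + v * (P - v)"
      unfolding yu y2_def inner_commute[of _ "s\<^sub>2 u + v *\<^sub>R e\<^sub>2 u"]
      by (simp add: i s2_dot_e1[OF u] e1_dot_e2[OF u] e_dot_e2[OF u] flip: P_def k_def)
    have y1y1: "y1 u \<bullet> y1 u = (\<delta> u / k)\<^sup>2 + (\<delta> u)\<^sup>2 + v\<^sup>2"
      by (simp add: y1u i f power2_eq_square)
    have g0: "(\<lambda>t. q (ruled s e t v)) = (\<lambda>t. k\<^sup>2 * (y t \<bullet> y t) - (y t \<bullet> d)\<^sup>2 - (\<delta> u)\<^sup>2)"
      by (simp add: q_def y_def)
    have "((\<lambda>t. q (ruled s e t v)) has_real_derivative g1 t) (at t)" if "t \<in> I" for t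
      unfolding g0 g1_def
      by (rule derivative_eq_intros inner_d const_d yd that refl)+ (simp add: inner_commute algebra_simps)
    then have dg: "deriv (\<lambda>t. q (ruled s e t v)) t = g1 t" if "t \<in> I" for t
      using that by (simp add: DERIV_imp_deriv)
    have "(g1 has_real_derivative
        2 * (k\<^sup>2 * (y u \<bullet> y2 + y1 u \<bullet> y1 u) - ((y u \<bullet> d) * (y2 \<bullet> d) + (y1 u \<bullet> d)\<^sup>2))) (at u)"
      unfolding g1_def
      by (rule derivative_eq_intros inner_d const_d yd y1d u refl)+ (simp add: algebra_simps power2_eq_square)
    moreover have "k\<^sup>2 * (y u \<bullet> y2 + y1 u \<bullet> y1 u) - ((y u \<bullet> d) * (y2 \<bullet> d) + (y1 u \<bullet> d)\<^sup>2) = 0"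
      unfolding yy2 y1y1 ydu y2d y1d0 l using k by (simp add: field_simps power2_eq_square)
    ultimately have "(g1 has_real_derivative 0) (at u)" by simp
    then have "(deriv (\<lambda>t. q (ruled s e t v)) has_real_derivative 0) (at u)"
      by (rule has_field_derivative_transform_within_open[OF _ open_I u]) (simp add: dg)
    then have 2: "deriv (deriv (\<lambda>t. q (ruled s e t v))) u = 0" by (rule DERIV_imp_deriv)
    have 1: "deriv (\<lambda>t. q (ruled s e t v)) u = 0"
      using dg[OF u] by (simp add: g1_def yy1 y1d0)
    have 0: "q (ruled s e u v) = 0"
      using fun_cong[OF g0, of u] k by (simp add: ydu) (simp add: yu i f power2_eq_square field_simps)
    from \<open>j \<le> 2\<close> have "j = 0 \<or> j = 1 \<or> j = 2" by auto
    then show ?thesis using 0 1 2 by (auto simp: numeral_2_eq_2)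
  qed
  ultimately have "osculating_quadric (ruled s e) u {X. q X = 0}"
    unfolding osculating_quadric_def by blast
  moreover have "rotational_hyperboloid {X. q X = 0}"
  proof -
    define D where "D = (1 / sqrt (k\<^sup>2 + 1)) *\<^sub>R d"
    have k1: "k\<^sup>2 + 1 > 0" by (auto intro!: add_nonneg_pos)
    have "norm D = 1" using k1 by (simp add: D_def norm_eq_sqrt_inner dd)
    have "((norm (X - m))\<^sup>2 - ((X - m) \<bullet> D)\<^sup>2) / \<bar>\<delta> u / k\<bar>\<^sup>2 - ((X - m) \<bullet> D)\<^sup>2 / \<bar>\<delta> u\<bar>\<^sup>2 = 1 \<longleftrightarrow> q X = 0" for X
    proof -
      define a b where "a = (X - m) \<bullet> (X - m)" and "b = ((X - m) \<bullet> D)\<^sup>2"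
      have "((X - m) \<bullet> d)\<^sup>2 = (k\<^sup>2 + 1) * b"
        using k1 by (simp add: b_def D_def power_divide)
      then have "q X = k\<^sup>2 * (a - b) - b - (\<delta> u)\<^sup>2" by (simp add: q_def a_def algebra_simps)
      moreover have "(a - b) / \<bar>\<delta> u / k\<bar>\<^sup>2 - b / \<bar>\<delta> u\<bar>\<^sup>2 = (k\<^sup>2 * (a - b) - b) / (\<delta> u)\<^sup>2"
        using k d0 by (simp add: field_simps)
      ultimately show ?thesis
        unfolding power2_norm_eq_inner a_def[symmetric] b_def[symmetric] using d0 by auto
    qed
    then have "{X. q X = 0} = {X. ((norm (X - m))\<^sup>2 - ((X - m) \<bullet> D)\<^sup>2) / \<bar>\<delta> u / k\<bar>\<^sup>2
        - ((X - m) \<bullet> D)\<^sup>2 / \<bar>\<delta> u\<bar>\<^sup>2 = 1}" by blast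
    moreover have "\<bar>\<delta> u / k\<bar> > 0" "\<bar>\<delta> u\<bar> > 0" using k d0 by auto
    ultimately show ?thesis unfolding rotational_hyperboloid_def using \<open>norm D = 1\<close> by blast
  qed
  ultimately show ?thesis by blast
qed

end

section \<open>From the alternatives on each ruling to the classification of the surface\<close>

theorem proposition6:
  fixes I :: "real set" and s e :: "real \<Rightarrow> real^3" and f :: "real \<Rightarrow> real" and n :: int
  assumes "skew_ruled_C3 I s e"
    and "continuous_on I f"
    and "\<And>J c t. constant_curvature_curve (ruled s e) I J c \<Longrightarrow> t \<in> J \<Longrightarrow>
           normal_curvature (ruled s e) (fst (c t)) (snd (c t))
             (fst (vderiv c t)) (snd (vderiv c t))
           = f (fst (c t)) * dist_w s e (fst (c t)) (snd (c t)) powi n"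
  shows "((\<forall>u\<in>I. f u = 0) \<and> right_helicoid I s e) \<or>
         (n = -1 \<and> (\<forall>u\<in>I. f u = - con_curv e u) \<and>
          ((orthoid I s e \<and> constant_dist_param I s e) \<or> edlinger I s e))"
proof -
  interpret skew_ruled_surface I s e by unfold_locales (rule assms(1))
  have pointwise: "deriv \<delta> u = 0 \<and> f u = - \<kappa> u \<and>
      (f u = 0 \<and> \<Lambda> u = 0 \<or> n = - 1 \<and> (\<Lambda> u = 0 \<or> \<kappa> u * \<Lambda> u = - 1))" if u: "u \<in> I" for u
  proof (rule normal_curvature_relation[OF delta_nonzero[OF u]])
    fix v :: real assume "v \<noteq> 0"
    let ?q = "deriv \<delta> u * (v\<^sup>2 - (\<delta> u)\<^sup>2) / (2 * \<delta> u * v)"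
    obtain J c where "constant_curvature_curve (ruled s e) I J c" "u \<in> J" "c u = (u, v)"
      "vderiv c u = (1, ?q)"
      using constant_curvature_curve_through[OF u \<open>v \<noteq> 0\<close>] by blast
    then have "normal_curvature (ruled s e) u v 1 ?q = f u * sqrt (v\<^sup>2 + (\<delta> u)\<^sup>2) powi n"
      using assms(3)[of J c u] by (simp add: dist_w_def)
    then show "(- (\<kappa> u * v\<^sup>2 + deriv \<delta> u * v + (\<delta> u)\<^sup>2 * (\<kappa> u - \<Lambda> u)) + 2 * \<delta> u * ?q) / sqrt (v\<^sup>2 + (\<delta> u)\<^sup>2) /
      (v\<^sup>2 + (\<delta> u)\<^sup>2 * ((\<Lambda> u)\<^sup>2 + 1) + 2 * (\<delta> u * \<Lambda> u) * ?q + ?q\<^sup>2) = f u * sqrt (v\<^sup>2 + (\<delta> u)\<^sup>2) powi n"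
      unfolding normal_curvature_ruled[OF u] .
  qed
  show ?thesis
  proof (cases "\<forall>u\<in>I. f u = 0 \<and> \<Lambda> u = 0")
    case True
    then show ?thesis using pointwise by (auto simp: right_helicoid_def)
  next
    case False
    \<comment> \<open>Some ruling violates the first alternative, and the remaining one fixes the
      exponent, which is the same for all rulings.\<close>
    then have n: "n = - 1" using pointwise by blast
    have "(\<forall>u\<in>I. \<Lambda> u = 0) \<or> (\<forall>u\<in>I. \<kappa> u * \<Lambda> u = - 1)"
    proof -
      have "(\<lambda>u. \<kappa> u * \<Lambda> u) constant_on I"
      proof (rule continuous_finite_range_constant)
        show "connected I" using is_interval_I by (rule is_interval_connected)
        show "continuous_on I (\<lambda>u. \<kappa> u * \<Lambda> u)"
          by (intro continuous_intros continuous_kappa continuous_lam)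
        have "(\<lambda>u. \<kappa> u * \<Lambda> u) ` I \<subseteq> {0, - 1}" using pointwise by fastforce
        then show "finite ((\<lambda>u. \<kappa> u * \<Lambda> u) ` I)" by (rule finite_subset) simp
      qed
      then obtain a where "\<And>u. u \<in> I \<Longrightarrow> \<kappa> u * \<Lambda> u = a" by (auto simp: constant_on_def)
      \<comment> \<open>If the constant \<open>a\<close> differs from -1, every remaining
        alternative on a ruling says that \<lambda> itself vanishes, not merely the product.\<close>
      with pointwise show ?thesis by (cases "a = - 1") force+
    qed
    \<comment> \<open>For \<lambda> = 0, \<open>lam_eq\<close> makes \<open>s\<^sub>1\<close>
      orthogonal to \<open>e\<close>; otherwise each ruling carries the hyperboloid constructed
      above, as \<delta>' = 0 everywhere.\<close>
    then have "(orthoid I s e \<and> constant_dist_param I s e) \<or> edlinger I s e"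
      using pointwise lam_eq rotational_osculating_quadric
      by (auto simp: orthoid_def constant_dist_param_def edlinger_def)
    then show ?thesis using n pointwise by simp
  qed
qed

end
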